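(* For every game logic formula $\xi$ in normal form, if the monotone $\mu$-calculus formula $\xi^{\sharp}$ is provable in $\mathsf{Clo}_{\mathsf{M}}$, then $\xi$ is provable in $\mathsf{Clo}_{\mathsf{G}}$.
   Context: Game logic formulas in normal form are generated by $\phi ::= p \mid \neg p \mid \phi\lor\phi \mid \phi\land\phi \mid \langle\gamma\rangle\phi$ with games $\gamma ::= g \mid g^d \mid \gamma;\gamma \mid \gamma\sqcup\gamma \mid \gamma\sqcap\gamma \mid \gamma^* \mid \gamma^{\times} \mid \phi? \mid \phi!$ (angelic/demonic choice, angelic/demonic iteration, angelic/demonic test). Formulas of the form $\langle\gamma^*\rangle\phi$ and $\langle\gamma^\times\rangle\phi$ are fixpoint formulas, ordered by $\langle\gamma^\circ\rangle\phi < \langle\delta^\dagger\rangle\psi$ iff $\delta^\dagger$ is a strict subterm of $\gamma^\circ$. The monotone $\mu$-calculus has formulas $p,\neg p,x,A\lor B,A\land B,\langle g\rangle A,\langle g^d\rangle A,\mu x.A,\nu x.A$, interpreted over monotone neighbourhood (game) models. The translation $(-)^\sharp$ from game logic to the monotone $\mu$-calculus is defined by: $p^\sharp=p$, $(\neg p)^\sharp=\neg p$, $\sharp$ commutes with $\land,\lor$, and $(\langle\gamma\rangle\varphi)^\sharp=\tau^{\gamma}_{\varphi}(\varphi^\sharp)$, where $\tau^{g}_{\varphi}(A)=\langle g\rangle A$, $\tau^{g^d}_{\varphi}(A)=\langle g^d\rangle A$, $\tau^{\gamma\sqcap\delta}_{\varphi}(A)=\tau^{\gamma}_{\varphi}(A)\land\tau^{\delta}_{\varphi}(A)$,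 $\tau^{\gamma\sqcup\delta}_{\varphi}(A)=\tau^{\gamma}_{\varphi}(A)\lor\tau^{\delta}_{\varphi}(A)$, $\tau^{\gamma^*}_{\varphi}(A)=\mu x^{\langle\gamma^*\rangle\varphi}.\,A\lor\tau^{\gamma}_{\langle\gamma^*\rangle\varphi}(x^{\langle\gamma^*\rangle\varphi})$, $\tau^{\gamma^\times}_{\varphi}(A)=\nu x^{\langle\gamma^\times\rangle\varphi}.\,A\land\tau^{\gamma}_{\langle\gamma^\times\rangle\varphi}(x^{\langle\gamma^\times\rangle\varphi})$, $\tau^{\gamma;\delta}_{\varphi}(A)=\tau^{\gamma}_{\langle\delta\rangle\varphi}(\tau^{\delta}_{\varphi}(A))$, $\tau^{\psi?}_{\varphi}(A)=\psi^\sharp\land A$, $\tau^{\psi!}_{\varphi}(A)=\psi^\sharp\lor A$. (Fixpoint variables are tagged with the game logic fixpoint formula they come from.) $\mathsf{Clo}_{\mathsf{G}}$ is a cut-free annotated sequent calculus for normal-form game logic: formulas carry annotations (sequences of names for greatest fixpoint formulas $\langle\gamma^\times\rangle\varphi$, monotone w.r.t. the fixpoint order), with rules for the connectives, game operators, monotone modal rule, weakening, expansion of annotations, and a closure rule discharging repeated occurrences of $\Phi,\langle\gamma^\times\rangle\varphi^{ax}$; $\mathsf{Clo}_{\mathsf{G}}\vdash\xi$ means there is a finite $\mathsf{Clo}_{\mathsf{G}}$-proof of $\xi$ with empty annotation. $\mathsf{Clo}_{\mathsf{M}}$ is the analogous annotated sequent calculus for the monotone $\mu$-calculus (the monotone variant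 of Afshari–Leigh's system Clo), parametric in an ambient formula $C$ whose fixpoint-variable priority order governs the side conditions; $\mathsf{Clo}_{\mathsf{M}}\vdash A$ means there is a $\mathsf{Clo}_{\mathsf{M}}[A]$-proof of $A$ with empty annotation. *)

theory Defs
  imports Main "HOL-Library.FSet" "HOL-Library.Sublist"
begin

section \<open>Game logic in normal form\<close>

datatype ('p, 'g) fm =
    Pos 'p
  | Neg 'p
  | Or "('p, 'g) fm" "('p, 'g) fm"
  | And "('p, 'g) fm" "('p, 'g) fm"
  | Dia "('p, 'g) game" "('p, 'g) fm"
and ('p, 'g) game =
    Atom 'g
  | DualAtom 'g
  | Seq "('p, 'g) game" "('p, 'g) game"
  | AChoice "('p, 'g) game" "('p, 'g) game"
  | DChoice "('p, 'g) game" "('p, 'g) game"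
  | AIter "('p, 'g) game"
  | DIter "('p, 'g) game"
  | ATest "('p, 'g) fm"
  | DTest "('p, 'g) fm"

text \<open>Games that are subterms of a formula or a game, including those inside tests.\<close>

primrec fm_games :: "('p, 'g) fm \<Rightarrow> ('p, 'g) game set"
  and subgames :: "('p, 'g) game \<Rightarrow> ('p, 'g) game set" where
  "fm_games (Pos p) = {}"
| "fm_games (Neg p) = {}"
| "fm_games (Or \<phi> \<psi>) = fm_games \<phi> \<union> fm_games \<psi>"
| "fm_games (And \<phi> \<psi>) = fm_games \<phi> \<union> fm_games \<psi>"
| "fm_games (Dia \<gamma> \<phi>) = subgames \<gamma> \<union> fm_games \<phi>"
| "subgames (Atom g) = {Atom g}"
| "subgames (DualAtom g) = {DualAtom g}"
| "subgames (Seq \<gamma> \<delta>) = insert (Seq \<gamma> \<delta>) (subgames \<gamma> \<union> subgames \<delta>)"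
| "subgames (AChoice \<gamma> \<delta>) = insert (AChoice \<gamma> \<delta>) (subgames \<gamma> \<union> subgames \<delta>)"
| "subgames (DChoice \<gamma> \<delta>) = insert (DChoice \<gamma> \<delta>) (subgames \<gamma> \<union> subgames \<delta>)"
| "subgames (AIter \<gamma>) = insert (AIter \<gamma>) (subgames \<gamma>)"
| "subgames (DIter \<gamma>) = insert (DIter \<gamma>) (subgames \<gamma>)"
| "subgames (ATest \<psi>) = insert (ATest \<psi>) (fm_games \<psi>)"
| "subgames (DTest \<psi>) = insert (DTest \<psi>) (fm_games \<psi>)"

definition is_iter :: "('p, 'g) game \<Rightarrow> bool" where
  "is_iter \<gamma> \<longleftrightarrow> (\<exists>\<delta>. \<gamma> = AIter \<delta> \<or> \<gamma> = DIter \<delta>)"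

definition is_gfp :: "('p, 'g) fm \<Rightarrow> bool" where
  "is_gfp \<phi> \<longleftrightarrow> (\<exists>\<gamma> \<psi>. \<phi> = Dia (DIter \<gamma>) \<psi>)"

inductive fp_less :: "('p, 'g) fm \<Rightarrow> ('p, 'g) fm \<Rightarrow> bool" where
  "\<lbrakk>is_iter \<gamma>; is_iter \<delta>; \<delta> \<in> subgames \<gamma>; \<delta> \<noteq> \<gamma>\<rbrakk> \<Longrightarrow> fp_less (Dia \<gamma> \<phi>) (Dia \<delta> \<psi>)"

definition fp_le :: "('p, 'g) fm \<Rightarrow> ('p, 'g) fm \<Rightarrow> bool" where
  "fp_le \<phi> \<psi> \<longleftrightarrow> \<phi> = \<psi> \<or> fp_less \<phi> \<psi>"


section \<open>The monotone \<open>\<mu>\<close>-calculus\<close>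

datatype ('p, 'g, 'v) mfm =
    MPos 'p
  | MNeg 'p
  | MVar 'v
  | MOr "('p, 'g, 'v) mfm" "('p, 'g, 'v) mfm"
  | MAnd "('p, 'g, 'v) mfm" "('p, 'g, 'v) mfm"
  | MDia 'g "('p, 'g, 'v) mfm"
  | MDualDia 'g "('p, 'g, 'v) mfm"
  | Mu 'v "('p, 'g, 'v) mfm"
  | Nu 'v "('p, 'g, 'v) mfm"

primrec fv :: "('p, 'g, 'v) mfm \<Rightarrow> 'v set" where
  "fv (MPos p) = {}"
| "fv (MNeg p) = {}"
| "fv (MVar x) = {x}"
| "fv (MOr A B) = fv A \<union> fv B"
| "fv (MAnd A B) = fv A \<union> fv B"
| "fv (MDia g A) = fv A"
| "fv (MDualDia g A) = fv A"
| "fv (Mu x A) = fv A - {x}"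
| "fv (Nu x A) = fv A - {x}"

primrec subfms :: "('p, 'g, 'v) mfm \<Rightarrow> ('p, 'g, 'v) mfm set" where
  "subfms (MPos p) = {MPos p}"
| "subfms (MNeg p) = {MNeg p}"
| "subfms (MVar x) = {MVar x}"
| "subfms (MOr A B) = insert (MOr A B) (subfms A \<union> subfms B)"
| "subfms (MAnd A B) = insert (MAnd A B) (subfms A \<union> subfms B)"
| "subfms (MDia g A) = insert (MDia g A) (subfms A)"
| "subfms (MDualDia g A) = insert (MDualDia g A) (subfms A)"
| "subfms (Mu x A) = insert (Mu x A) (subfms A)"
| "subfms (Nu x A) = insert (Nu x A) (subfms A)"

text \<open>
  \<open>msubst x B A\<close> replaces the free occurrences of \<open>x\<close> in \<open>A\<close> by \<open>B\<close>. Bound variables are not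
  renamed: in a derivation of a closed formula only closed fixpoint formulas are unfolded, so
  no variable is ever captured.
\<close>

primrec msubst :: "'v \<Rightarrow> ('p, 'g, 'v) mfm \<Rightarrow> ('p, 'g, 'v) mfm \<Rightarrow> ('p, 'g, 'v) mfm" where
  "msubst x B (MPos p) = MPos p"
| "msubst x B (MNeg p) = MNeg p"
| "msubst x B (MVar y) = (if y = x then B else MVar y)"
| "msubst x B (MOr A A') = MOr (msubst x B A) (msubst x B A')"
| "msubst x B (MAnd A A') = MAnd (msubst x B A) (msubst x B A')"
| "msubst x B (MDia g A) = MDia g (msubst x B A)"
| "msubst x B (MDualDia g A) = MDualDia g (msubst x B A)"
| "msubst x B (Mu y A) = (if y = x then Mu y A else Mu y (msubst x B A))"
| "msubst x B (Nu y A) = (if y = x then Nu y A else Nu y (msubst x B A))"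

text \<open>
  The priority order on the fixpoint variables of \<open>C\<close>: \<open>x\<close> is above \<open>y\<close> if \<open>x\<close> occurs free in
  a subformula of \<open>C\<close> that binds \<open>y\<close>; close under transitivity.
\<close>

definition dep :: "('p, 'g, 'v) mfm \<Rightarrow> 'v \<Rightarrow> 'v \<Rightarrow> bool" where
  "dep C x y \<longleftrightarrow> (\<exists>B. (Mu y B \<in> subfms C \<and> x \<in> fv (Mu y B))
                     \<or> (Nu y B \<in> subfms C \<and> x \<in> fv (Nu y B)))"

definition var_less :: "('p, 'g, 'v) mfm \<Rightarrow> 'v \<Rightarrow> 'v \<Rightarrow> bool" where
  "var_less C = tranclp (dep C)"

definition var_le :: "('p, 'g, 'v) mfm \<Rightarrow> 'v \<Rightarrow> 'v \<Rightarrow> bool" where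
  "var_le C x y \<longleftrightarrow> x = y \<or> var_less C x y"


section \<open>The translation\<close>

text \<open>The fixpoint variables of the target are the game logic fixpoint formulas themselves.\<close>

fun sharp :: "('p, 'g) fm \<Rightarrow> ('p, 'g, ('p, 'g) fm) mfm"
  and tau :: "('p, 'g) game \<Rightarrow> ('p, 'g) fm \<Rightarrow> ('p, 'g, ('p, 'g) fm) mfm
                \<Rightarrow> ('p, 'g, ('p, 'g) fm) mfm" where
  "sharp (Pos p) = MPos p"
| "sharp (Neg p) = MNeg p"
| "sharp (Or \<phi> \<psi>) = MOr (sharp \<phi>) (sharp \<psi>)"
| "sharp (And \<phi> \<psi>) = MAnd (sharp \<phi>) (sharp \<psi>)"
| "sharp (Dia \<gamma> \<phi>) = tau \<gamma> \<phi> (sharp \<phi>)"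
| "tau (Atom g) \<phi> A = MDia g A"
| "tau (DualAtom g) \<phi> A = MDualDia g A"
| "tau (Seq \<gamma> \<delta>) \<phi> A = tau \<gamma> (Dia \<delta> \<phi>) (tau \<delta> \<phi> A)"
| "tau (AChoice \<gamma> \<delta>) \<phi> A = MOr (tau \<gamma> \<phi> A) (tau \<delta> \<phi> A)"
| "tau (DChoice \<gamma> \<delta>) \<phi> A = MAnd (tau \<gamma> \<phi> A) (tau \<delta> \<phi> A)"
| "tau (AIter \<gamma>) \<phi> A =
     Mu (Dia (AIter \<gamma>) \<phi>) (MOr A (tau \<gamma> (Dia (AIter \<gamma>) \<phi>) (MVar (Dia (AIter \<gamma>) \<phi>))))"
| "tau (DIter \<gamma>) \<phi> A =
     Nu (Dia (DIter \<gamma>) \<phi>) (MAnd A (tau \<gamma> (Dia (DIter \<gamma>) \<phi>) (MVar (Dia (DIter \<gamma>) \<phi>))))"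
| "tau (ATest \<psi>) \<phi> A = MAnd (sharp \<psi>) A"
| "tau (DTest \<psi>) \<phi> A = MOr (sharp \<psi>) A"

lemma sharp_closed: "fv (sharp (\<phi> :: ('p, 'g) fm)) = {}"
  and fv_tau: "fv (tau (\<gamma> :: ('p, 'g) game) \<psi> A) \<subseteq> fv A"
by (induction \<phi> and \<gamma> \<psi> A rule: sharp_tau.induct) auto



section \<open>Annotations and sequents\<close>

text \<open>
  A name is a pair \<open>(i, n)\<close>: the \<open>n\<close>-th name for the fixpoint variable (or fixpoint formula) \<open>i\<close>.
\<close>

type_synonym 'i annot = "('i \<times> nat) list"
type_synonym ('f, 'i) asequent = "('f \<times> 'i annot) fset"

definition is_annot :: "('i \<Rightarrow> 'i \<Rightarrow> bool) \<Rightarrow> 'i annot \<Rightarrow> bool" where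
  "is_annot le a \<longleftrightarrow> distinct a \<and> sorted_wrt (\<lambda>x y. le (fst x) (fst y)) a"

definition annot_le :: "('i \<Rightarrow> 'i \<Rightarrow> bool) \<Rightarrow> 'i annot \<Rightarrow> 'i \<Rightarrow> bool" where
  "annot_le le a i \<longleftrightarrow> (\<forall>x \<in> set a. le (fst x) i)"

definition seq_names :: "('f, 'i) asequent \<Rightarrow> ('i \<times> nat) set" where
  "seq_names \<Gamma> = (\<Union>(A, a) \<in> fset \<Gamma>. set a)"


section \<open>The two annotated calculi\<close>

text \<open>
  In both calculi \<open>H\<close> is the set of sequents that may be used as leaves because they are
  discharged by an application of the closure rule further down; a proof has no open leaves,
  i.e. \<open>H = {}\<close> at the root. The name introduced by a closure rule must also be fresh for \<open>H\<close>:
  this expresses the convention that distinct applications of the closure rule introduce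
  distinct names.

  Sequents are sets, so the principal formula of a rule may also belong to its context.
\<close>

inductive cloM :: "('p, 'g, 'v) mfm \<Rightarrow> (('p, 'g, 'v) mfm, 'v) asequent set
    \<Rightarrow> (('p, 'g, 'v) mfm, 'v) asequent \<Rightarrow> bool"
  for C :: "('p, 'g, 'v) mfm" where
  leaf: "\<Gamma> \<in> H \<Longrightarrow> cloM C H \<Gamma>"
| ax: "cloM C H {|(MPos p, []), (MNeg p, [])|}"
| disj: "cloM C H (finsert (A, a) (finsert (B, a) \<Gamma>)) \<Longrightarrow> cloM C H (finsert (MOr A B, a) \<Gamma>)"
| conj: "\<lbrakk>cloM C H (finsert (A, a) \<Gamma>); cloM C H (finsert (B, a) \<Gamma>)\<rbrakk>
    \<Longrightarrow> cloM C H (finsert (MAnd A B, a) \<Gamma>)"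
| modal: "cloM C H {|(A, a), (B, b)|} \<Longrightarrow> cloM C H {|(MDia g A, a), (MDualDia g B, b)|}"
| mu: "\<lbrakk>cloM C H (finsert (msubst x (Mu x A) A, a) \<Gamma>); annot_le (var_le C) a x\<rbrakk>
    \<Longrightarrow> cloM C H (finsert (Mu x A, a) \<Gamma>)"
| nu: "\<lbrakk>cloM C H (finsert (msubst x (Nu x A) A, a) \<Gamma>); annot_le (var_le C) a x\<rbrakk>
    \<Longrightarrow> cloM C H (finsert (Nu x A, a) \<Gamma>)"
| weak: "\<lbrakk>cloM C H \<Gamma>; is_annot (var_le C) a\<rbrakk> \<Longrightarrow> cloM C H (finsert (A, a) \<Gamma>)"
| exp: "\<lbrakk>cloM C H (finsert (A, a) \<Gamma>); subseq a b; is_annot (var_le C) b\<rbrakk>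
    \<Longrightarrow> cloM C H (finsert (A, b) \<Gamma>)"
| clo: "\<lbrakk>cloM C (insert (finsert (Nu x A, a @ [(x, n)]) \<Gamma>) H)
           (finsert (msubst x (Nu x A) A, a @ [(x, n)]) \<Gamma>);
         annot_le (var_le C) a x;
         (x, n) \<notin> set a; (x, n) \<notin> seq_names \<Gamma>; \<forall>\<Delta> \<in> H. (x, n) \<notin> seq_names \<Delta>\<rbrakk>
    \<Longrightarrow> cloM C H (finsert (Nu x A, a) \<Gamma>)"

definition provable_CloM :: "('p, 'g, 'v) mfm \<Rightarrow> bool" where
  "provable_CloM A \<longleftrightarrow> cloM A {} {|(A, [])|}"

text \<open>In game logic only greatest fixpoint formulas have names.\<close>

definition is_gannot :: "('p, 'g) fm annot \<Rightarrow> bool" where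
  "is_gannot a \<longleftrightarrow> is_annot fp_le a \<and> (\<forall>x \<in> set a. is_gfp (fst x))"

inductive cloG :: "(('p, 'g) fm, ('p, 'g) fm) asequent set
    \<Rightarrow> (('p, 'g) fm, ('p, 'g) fm) asequent \<Rightarrow> bool" where
  leaf: "\<Phi> \<in> H \<Longrightarrow> cloG H \<Phi>"
| ax: "cloG H {|(Pos p, []), (Neg p, [])|}"
| disj: "cloG H (finsert (\<phi>, a) (finsert (\<psi>, a) \<Phi>)) \<Longrightarrow> cloG H (finsert (Or \<phi> \<psi>, a) \<Phi>)"
| conj: "\<lbrakk>cloG H (finsert (\<phi>, a) \<Phi>); cloG H (finsert (\<psi>, a) \<Phi>)\<rbrakk>
    \<Longrightarrow> cloG H (finsert (And \<phi> \<psi>, a) \<Phi>)"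
| modal: "cloG H {|(\<phi>, a), (\<psi>, b)|}
    \<Longrightarrow> cloG H {|(Dia (Atom g) \<phi>, a), (Dia (DualAtom g) \<psi>, b)|}"
| comp: "cloG H (finsert (Dia \<gamma> (Dia \<delta> \<phi>), a) \<Phi>) \<Longrightarrow> cloG H (finsert (Dia (Seq \<gamma> \<delta>) \<phi>, a) \<Phi>)"
| achoice: "cloG H (finsert (Or (Dia \<gamma> \<phi>) (Dia \<delta> \<phi>), a) \<Phi>)
    \<Longrightarrow> cloG H (finsert (Dia (AChoice \<gamma> \<delta>) \<phi>, a) \<Phi>)"
| dchoice: "cloG H (finsert (And (Dia \<gamma> \<phi>) (Dia \<delta> \<phi>), a) \<Phi>)
    \<Longrightarrow> cloG H (finsert (Dia (DChoice \<gamma> \<delta>) \<phi>, a) \<Phi>)"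
| atest: "cloG H (finsert (And \<psi> \<phi>, a) \<Phi>) \<Longrightarrow> cloG H (finsert (Dia (ATest \<psi>) \<phi>, a) \<Phi>)"
| dtest: "cloG H (finsert (Or \<psi> \<phi>, a) \<Phi>) \<Longrightarrow> cloG H (finsert (Dia (DTest \<psi>) \<phi>, a) \<Phi>)"
| aiter: "\<lbrakk>cloG H (finsert (Or \<phi> (Dia \<gamma> (Dia (AIter \<gamma>) \<phi>)), a) \<Phi>);
           annot_le fp_le a (Dia (AIter \<gamma>) \<phi>)\<rbrakk>
    \<Longrightarrow> cloG H (finsert (Dia (AIter \<gamma>) \<phi>, a) \<Phi>)"
| diter: "\<lbrakk>cloG H (finsert (And \<phi> (Dia \<gamma> (Dia (DIter \<gamma>) \<phi>)), a) \<Phi>);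
           annot_le fp_le a (Dia (DIter \<gamma>) \<phi>)\<rbrakk>
    \<Longrightarrow> cloG H (finsert (Dia (DIter \<gamma>) \<phi>, a) \<Phi>)"
| weak: "\<lbrakk>cloG H \<Phi>; is_gannot a\<rbrakk> \<Longrightarrow> cloG H (finsert (\<phi>, a) \<Phi>)"
| exp: "\<lbrakk>cloG H (finsert (\<phi>, a) \<Phi>); subseq a b; is_gannot b\<rbrakk> \<Longrightarrow> cloG H (finsert (\<phi>, b) \<Phi>)"
| clo: "\<lbrakk>cloG (insert (finsert (Dia (DIter \<gamma>) \<phi>, a @ [(Dia (DIter \<gamma>) \<phi>, n)]) \<Phi>) H)
           (finsert (And \<phi> (Dia \<gamma> (Dia (DIter \<gamma>) \<phi>)), a @ [(Dia (DIter \<gamma>) \<phi>, n)]) \<Phi>);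
         annot_le fp_le a (Dia (DIter \<gamma>) \<phi>);
         (Dia (DIter \<gamma>) \<phi>, n) \<notin> set a; (Dia (DIter \<gamma>) \<phi>, n) \<notin> seq_names \<Phi>;
         \<forall>\<Delta> \<in> H. (Dia (DIter \<gamma>) \<phi>, n) \<notin> seq_names \<Delta>\<rbrakk>
    \<Longrightarrow> cloG H (finsert (Dia (DIter \<gamma>) \<phi>, a) \<Phi>)"

definition provable_CloG :: "('p, 'g) fm \<Rightarrow> bool" where
  "provable_CloG \<xi> \<longleftrightarrow> cloG {} {|(\<xi>, [])|}"

end

theory Submission
  imports Defs
begin

text \<open>
  A \<open>Clo\<^sub>M\<close>-proof of \<open>sharp \<xi>\<close> only contains formulas \<open>sharp \<phi>\<close> with \<open>\<phi>\<close> in the finite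
  Fischer-Ladner closure of \<open>\<xi>\<close>, and each \<open>Clo\<^sub>M\<close>-rule lifts to \<open>Clo\<^sub>G\<close>-rules once
  compositions, choices and tests at the head of \<open>\<phi>\<close> have been decomposed. The one obstacle is
  that \<open>sharp\<close> is not injective: when the \<open>\<mu>\<close>-calculus proof reaches a discharged leaf, the lifted
  sequent may differ from the lift of the sequent that it repeats. The loop is then unrolled once
  more. A sequent has only finitely many lifts, so the lift eventually repeats. To be able to close
  at any of the earlier passes, all names introduced so far are kept: one name of the
  \<open>\<mu>\<close>-calculus proof stands for a growing list of names in the game logic proof.
\<close>

section \<open>Comparison of the priority orders\<close>

lemma subgames_refl: "\<gamma> \<in> subgames \<gamma>"
  by (cases \<gamma>) auto

lemma subgames_trans_aux:
  fixes \<phi> :: "('p, 'g) fm" and \<gamma> :: "('p, 'g) game"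
  shows "\<delta> \<in> fm_games \<phi> \<Longrightarrow> subgames \<delta> \<subseteq> fm_games \<phi>"
    and "\<delta> \<in> subgames \<gamma> \<Longrightarrow> subgames \<delta> \<subseteq> subgames \<gamma>"
  by (induction \<phi> and \<gamma>) auto

lemma subgames_size:
  fixes \<phi> :: "('p, 'g) fm" and \<gamma> :: "('p, 'g) game"
  shows "\<delta> \<in> fm_games \<phi> \<Longrightarrow> size \<delta> < size \<phi>"
    and "\<delta> \<in> subgames \<gamma> \<Longrightarrow> size \<delta> \<le> size \<gamma>"
  by (induction \<phi> and \<gamma>) force+

lemma subgames_antisym: "\<delta> \<in> subgames \<gamma> \<Longrightarrow> \<gamma> \<in> subgames \<delta> \<Longrightarrow> \<gamma> = \<delta>"
proof (cases "\<delta> = \<gamma>")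
  case False
  have "size \<delta> < size \<gamma>" if "\<delta> \<in> subgames \<gamma>" "\<delta> \<noteq> \<gamma>" for \<delta> \<gamma> :: "('a, 'b) game"
    using that by (cases \<gamma>) (auto dest!: subgames_size)
  moreover assume "\<delta> \<in> subgames \<gamma>" "\<gamma> \<in> subgames \<delta>"
  ultimately show ?thesis using False by (metis less_asym)
qed simp

lemma iter_notin_subgames: "AIter \<gamma> \<notin> subgames \<gamma>" "DIter \<gamma> \<notin> subgames \<gamma>"
  by (auto dest: subgames_size)

text \<open>Antisymmetry of the subgame relation is what keeps the composite strict.\<close>

lemma fp_less_trans: "fp_less x y \<Longrightarrow> fp_less y z \<Longrightarrow> fp_less x z"
  by (auto simp: fp_less.simps dest: subgames_trans_aux(2) subgames_antisym)

text \<open>The second part leaves \<open>A\<close> open because an iteration puts its own variable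
  in that place. A binder that comes from the game then has that variable free only if it stems from
  an iteration inside the body, hence from a strict subgame. For \<open>sharp\<close> the argument
  is closed, so only \<open>fp_less\<close> survives.\<close>

lemma fv_binder_subfms:
  fixes \<phi> :: "('p, 'g) fm" and \<gamma> :: "('p, 'g) game"
  shows "D \<in> subfms (sharp \<phi>) \<Longrightarrow> D = Mu y B \<or> D = Nu y B \<Longrightarrow> x \<in> fv D \<Longrightarrow> fp_less x y"
    and "D \<in> subfms (tau \<gamma> \<psi> A) \<Longrightarrow> D = Mu y B \<or> D = Nu y B \<Longrightarrow> x \<in> fv D \<Longrightarrow>
      D \<in> subfms A \<or> fp_less x y \<or>
      x \<in> fv A \<and> (\<exists>\<delta> \<omega>. y = Dia \<delta> \<omega> \<and> is_iter \<delta> \<and> \<delta> \<in> subgames \<gamma>)"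
proof (induction \<phi> and \<gamma> \<psi> A rule: sharp_tau.induct)
  case (5 \<gamma> \<phi>)
  then show ?case by (auto simp: sharp_closed)
next
  case (8 \<gamma> \<delta> \<phi> A)
  then show ?case using fv_tau[of \<delta> \<phi> A] by fastforce
next
  case (11 \<gamma> \<phi> A)
  have "fp_less (Dia (AIter \<gamma>) \<phi>) y" if "y = Dia \<delta> \<omega>" "is_iter \<delta>" "\<delta> \<in> subgames \<gamma>" for \<delta> \<omega>
    using that iter_notin_subgames(1)[of \<gamma>] by (auto simp: is_iter_def intro!: fp_less.intros)
  moreover have "is_iter (AIter \<gamma>)" by (simp add: is_iter_def)
  ultimately show ?case using 11 fv_tau[of \<gamma> "Dia (AIter \<gamma>) \<phi>" "MVar (Dia (AIter \<gamma>) \<phi>)"]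
    by auto
next
  case (12 \<gamma> \<phi> A)
  have "fp_less (Dia (DIter \<gamma>) \<phi>) y" if "y = Dia \<delta> \<omega>" "is_iter \<delta>" "\<delta> \<in> subgames \<gamma>" for \<delta> \<omega>
    using that iter_notin_subgames(2)[of \<gamma>] by (auto simp: is_iter_def intro!: fp_less.intros)
  moreover have "is_iter (DIter \<gamma>)" by (simp add: is_iter_def)
  ultimately show ?case using 12 fv_tau[of \<gamma> "Dia (DIter \<gamma>) \<phi>" "MVar (Dia (DIter \<gamma>) \<phi>)"]
    by auto
qed auto

text \<open>As \<open>fp_less\<close> is transitive and contains \<open>dep\<close>, it contains the
  closure of \<open>dep\<close>. Side conditions of the mu-calculus rules thus imply those of the
  game logic rules.\<close>

lemma var_le_sharp_imp_fp_le:
  assumes "var_le (sharp \<xi>) x y"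
  shows "fp_le x y"
proof -
  have dep: "fp_less x y" if "dep (sharp \<xi>) x y" for x y
    using that fv_binder_subfms(1)[of _ \<xi> y _ x] unfolding dep_def by blast
  have "fp_less x y" if "(dep (sharp \<xi>))\<^sup>+\<^sup>+ x y"
    using that by induction (auto intro: dep fp_less_trans)
  then show ?thesis using assms by (auto simp: var_le_def var_less_def fp_le_def)
qed


section \<open>Unfolding of translated fixpoints\<close>

lemma msubst_closed: "x \<notin> fv A \<Longrightarrow> msubst x B A = A"
  by (induction A) auto

text \<open>All free variables of \<open>tau \<gamma> \<phi> A\<close> come from \<open>A\<close>.
  The assumption says that no iteration of \<open>\<gamma>\<close> binds \<open>x\<close>, so the
  substitution reaches every copy of \<open>A\<close> and changes nothing else.\<close>

lemma msubst_tau: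
  assumes "\<And>\<delta> \<omega>. x = Dia \<delta> \<omega> \<Longrightarrow> \<delta> \<notin> subgames \<gamma>"
  shows "msubst x B (tau \<gamma> \<phi> A) = tau \<gamma> \<phi> (msubst x B A)"
  using assms
proof (induction \<gamma> arbitrary: \<phi> A rule: game.induct[where ?P1.0 = "\<lambda>_. True"])
  case (AIter \<gamma>)
  then have "x \<noteq> Dia (AIter \<gamma>) \<phi>" by auto
  then show ?case using fv_tau[of \<gamma> "Dia (AIter \<gamma>) \<phi>" "MVar (Dia (AIter \<gamma>) \<phi>)"]
    by (auto intro!: msubst_closed)
next
  case (DIter \<gamma>)
  then have "x \<noteq> Dia (DIter \<gamma>) \<phi>" by auto
  then show ?case using fv_tau[of \<gamma> "Dia (DIter \<gamma>) \<phi>" "MVar (Dia (DIter \<gamma>) \<phi>)"]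
    by (auto intro!: msubst_closed)
qed (auto simp: msubst_closed sharp_closed)

text \<open>Unfolding stays in the image of \<open>sharp\<close>: \<open>sharp \<phi>\<close> is
  closed, and the variable passed to \<open>tau \<gamma>\<close> becomes the translation of the
  fixpoint formula itself.\<close>

lemma msubst_sharp_AIter:
  assumes "sharp (Dia (AIter \<gamma>) \<phi>) = Mu x A"
  shows "msubst x (Mu x A) A = sharp (Or \<phi> (Dia \<gamma> (Dia (AIter \<gamma>) \<phi>)))"
proof -
  let ?x = "Dia (AIter \<gamma>) \<phi>"
  have "x = ?x" "A = MOr (sharp \<phi>) (tau \<gamma> ?x (MVar ?x))" using assms by auto
  moreover have "msubst ?x B (tau \<gamma> ?x (MVar ?x)) = tau \<gamma> ?x B" for B
    using iter_notin_subgames(1)[of \<gamma>] by (subst msubst_tau) auto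
  ultimately show ?thesis by (simp add: msubst_closed sharp_closed)
qed

lemma msubst_sharp_DIter:
  assumes "sharp (Dia (DIter \<gamma>) \<phi>) = Nu x A"
  shows "msubst x (Nu x A) A = sharp (And \<phi> (Dia \<gamma> (Dia (DIter \<gamma>) \<phi>)))"
proof -
  let ?x = "Dia (DIter \<gamma>) \<phi>"
  have "x = ?x" "A = MAnd (sharp \<phi>) (tau \<gamma> ?x (MVar ?x))" using assms by auto
  moreover have "msubst ?x B (tau \<gamma> ?x (MVar ?x)) = tau \<gamma> ?x B" for B
    using iter_notin_subgames(2)[of \<gamma>] by (subst msubst_tau) auto
  ultimately show ?thesis by (simp add: msubst_closed sharp_closed)
qed


section \<open>The Fischer-Ladner closure\<close>

text \<open>The steps lead from the principal formula of a logical rule of \<open>cloG\<close> to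
  its active formulas in the premises.\<close>

inductive fl_step :: "('p, 'g) fm \<Rightarrow> ('p, 'g) fm \<Rightarrow> bool" where
  "fl_step (Or \<phi> \<psi>) \<phi>"
| "fl_step (Or \<phi> \<psi>) \<psi>"
| "fl_step (And \<phi> \<psi>) \<phi>"
| "fl_step (And \<phi> \<psi>) \<psi>"
| "fl_step (Dia (Atom g) \<phi>) \<phi>"
| "fl_step (Dia (DualAtom g) \<phi>) \<phi>"
| "fl_step (Dia (Seq \<gamma> \<delta>) \<phi>) (Dia \<gamma> (Dia \<delta> \<phi>))"
| "fl_step (Dia (AChoice \<gamma> \<delta>) \<phi>) (Or (Dia \<gamma> \<phi>) (Dia \<delta> \<phi>))"
| "fl_step (Dia (DChoice \<gamma> \<delta>) \<phi>) (And (Dia \<gamma> \<phi>) (Dia \<delta> \<phi>))"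
| "fl_step (Dia (AIter \<gamma>) \<phi>) (Or \<phi> (Dia \<gamma> (Dia (AIter \<gamma>) \<phi>)))"
| "fl_step (Dia (DIter \<gamma>) \<phi>) (And \<phi> (Dia \<gamma> (Dia (DIter \<gamma>) \<phi>)))"
| "fl_step (Dia (ATest \<psi>) \<phi>) (And \<psi> \<phi>)"
| "fl_step (Dia (DTest \<psi>) \<phi>) (Or \<psi> \<phi>)"

text \<open>\<open>FLg \<gamma> \<phi>\<close> leaves out the closure of \<open>\<phi>\<close>. With
  it, the clauses for iteration would call themselves on the same fixpoint formula; without it, the
  recursion is structural in the game and finiteness is immediate.\<close>

fun FL :: "('p, 'g) fm \<Rightarrow> ('p, 'g) fm set"
  and FLg :: "('p, 'g) game \<Rightarrow> ('p, 'g) fm \<Rightarrow> ('p, 'g) fm set" where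
  "FL (Pos p) = {Pos p}"
| "FL (Neg p) = {Neg p}"
| "FL (Or \<phi> \<psi>) = insert (Or \<phi> \<psi>) (FL \<phi> \<union> FL \<psi>)"
| "FL (And \<phi> \<psi>) = insert (And \<phi> \<psi>) (FL \<phi> \<union> FL \<psi>)"
| "FL (Dia \<gamma> \<phi>) = FLg \<gamma> \<phi> \<union> FL \<phi>"
| "FLg (Atom g) \<phi> = {Dia (Atom g) \<phi>}"
| "FLg (DualAtom g) \<phi> = {Dia (DualAtom g) \<phi>}"
| "FLg (Seq \<gamma> \<delta>) \<phi> = insert (Dia (Seq \<gamma> \<delta>) \<phi>) (FLg \<gamma> (Dia \<delta> \<phi>) \<union> FLg \<delta> \<phi>)"
| "FLg (AChoice \<gamma> \<delta>) \<phi> =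
     {Dia (AChoice \<gamma> \<delta>) \<phi>, Or (Dia \<gamma> \<phi>) (Dia \<delta> \<phi>)} \<union> FLg \<gamma> \<phi> \<union> FLg \<delta> \<phi>"
| "FLg (DChoice \<gamma> \<delta>) \<phi> =
     {Dia (DChoice \<gamma> \<delta>) \<phi>, And (Dia \<gamma> \<phi>) (Dia \<delta> \<phi>)} \<union> FLg \<gamma> \<phi> \<union> FLg \<delta> \<phi>"
| "FLg (AIter \<gamma>) \<phi> =
     {Dia (AIter \<gamma>) \<phi>, Or \<phi> (Dia \<gamma> (Dia (AIter \<gamma>) \<phi>))} \<union> FLg \<gamma> (Dia (AIter \<gamma>) \<phi>)"
| "FLg (DIter \<gamma>) \<phi> =
     {Dia (DIter \<gamma>) \<phi>, And \<phi> (Dia \<gamma> (Dia (DIter \<gamma>) \<phi>))} \<union> FLg \<gamma> (Dia (DIter \<gamma>) \<phi>)"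
| "FLg (ATest \<psi>) \<phi> = {Dia (ATest \<psi>) \<phi>, And \<psi> \<phi>} \<union> FL \<psi>"
| "FLg (DTest \<psi>) \<phi> = {Dia (DTest \<psi>) \<phi>, Or \<psi> \<phi>} \<union> FL \<psi>"

lemma finite_FL:
  fixes \<phi> :: "('p, 'g) fm" and \<gamma> :: "('p, 'g) game"
  shows "finite (FL \<phi>)" and "\<And>\<psi>. finite (FLg \<gamma> \<psi>)"
  by (induction \<phi> and \<gamma>) auto

lemma FLg_refl: "Dia \<gamma> \<phi> \<in> FLg \<gamma> \<phi>"
  by (cases \<gamma>) auto

lemma FL_refl: "\<phi> \<in> FL \<phi>"
  by (cases \<phi>) (auto simp: FLg_refl)

inductive_cases fl_stepE: "fl_step \<phi> \<psi>"

text \<open>A step that finishes the game \<open>\<gamma>\<close> lands in the continuation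
  \<open>\<psi>\<close>, hence the extra \<open>FL \<psi>\<close>. For an iteration the continuation
  of the body is the fixpoint formula, whose closure is already accounted for.\<close>

lemma FL_closed:
  fixes \<phi> :: "('p, 'g) fm" and \<gamma> :: "('p, 'g) game"
  shows "\<chi> \<in> FL \<phi> \<Longrightarrow> fl_step \<chi> \<chi>' \<Longrightarrow> \<chi>' \<in> FL \<phi>"
    and "\<And>\<psi>. \<chi> \<in> FLg \<gamma> \<psi> \<Longrightarrow> fl_step \<chi> \<chi>' \<Longrightarrow> \<chi>' \<in> FLg \<gamma> \<psi> \<union> FL \<psi>"
proof (induction \<phi> and \<gamma>)
qed (fastforce simp: FLg_refl FL_refl elim: fl_stepE)+


section \<open>Decomposition of the head game\<close>

text \<open>On the remaining formulas the outermost connective or game can be read off from the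
  translation. The excluded ones share their translation with the formula obtained by decomposing
  the outermost game.\<close>

fun is_head :: "('p, 'g) fm \<Rightarrow> bool" where
  "is_head (Dia (Seq \<gamma> \<delta>) \<phi>) = False"
| "is_head (Dia (AChoice \<gamma> \<delta>) \<phi>) = False"
| "is_head (Dia (DChoice \<gamma> \<delta>) \<phi>) = False"
| "is_head (Dia (ATest \<psi>) \<phi>) = False"
| "is_head (Dia (DTest \<psi>) \<phi>) = False"
| "is_head \<phi> = True"

text \<open>The chain of decompositions is recorded only through its effect on derivability, in
  every context and with the annotation unchanged.\<close>

definition head_of :: "('p, 'g) fm \<Rightarrow> ('p, 'g) fm \<Rightarrow> bool" where
  "head_of \<phi> \<psi> \<longleftrightarrow> is_head \<psi> \<and> sharp \<psi> = sharp \<phi> \<and>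
     (\<forall>K b \<Phi>. cloG K (finsert (\<psi>, b) \<Phi>) \<longrightarrow> cloG K (finsert (\<phi>, b) \<Phi>))"

lemma cloG_head_of: "head_of \<phi> \<psi> \<Longrightarrow> cloG K (finsert (\<psi>, b) \<Phi>) \<Longrightarrow> cloG K (finsert (\<phi>, b) \<Phi>)"
  by (simp add: head_of_def)

lemma head_of_refl: "is_head \<phi> \<Longrightarrow> head_of \<phi> \<phi>"
  by (simp add: head_of_def)

text \<open>Only a composition needs the induction hypothesis: a choice or a test turns into a
  disjunction or conjunction in one step, and that is already a head.\<close>

lemma ex_head_of_Dia: "Dia \<gamma> \<phi> \<in> FL \<xi> \<Longrightarrow> \<exists>\<psi> \<in> FL \<xi>. head_of (Dia \<gamma> \<phi>) \<psi>"
proof (induction \<gamma> arbitrary: \<phi> rule: game.induct[where ?P1.0 = "\<lambda>_. True"])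
  case (Seq \<gamma> \<delta>)
  then obtain \<psi> where "\<psi> \<in> FL \<xi>" "head_of (Dia \<gamma> (Dia \<delta> \<phi>)) \<psi>"
    by (meson FL_closed(1) fl_step.intros)
  moreover from this have "head_of (Dia (Seq \<gamma> \<delta>) \<phi>) \<psi>"
    unfolding head_of_def by (auto intro: cloG.comp)
  ultimately show ?case by blast
next
  case (AChoice \<gamma> \<delta>)
  then have "Or (Dia \<gamma> \<phi>) (Dia \<delta> \<phi>) \<in> FL \<xi>" by (meson FL_closed(1) fl_step.intros)
  moreover have "head_of (Dia (AChoice \<gamma> \<delta>) \<phi>) (Or (Dia \<gamma> \<phi>) (Dia \<delta> \<phi>))"
    by (auto simp: head_of_def intro: cloG.intros)
  ultimately show ?case by blast
next
  case (DChoice \<gamma> \<delta>)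
  then have "And (Dia \<gamma> \<phi>) (Dia \<delta> \<phi>) \<in> FL \<xi>" by (meson FL_closed(1) fl_step.intros)
  moreover have "head_of (Dia (DChoice \<gamma> \<delta>) \<phi>) (And (Dia \<gamma> \<phi>) (Dia \<delta> \<phi>))"
    by (auto simp: head_of_def intro: cloG.intros)
  ultimately show ?case by blast
next
  case (ATest \<psi>)
  then have "And \<psi> \<phi> \<in> FL \<xi>" by (meson FL_closed(1) fl_step.intros)
  moreover have "head_of (Dia (ATest \<psi>) \<phi>) (And \<psi> \<phi>)"
    by (auto simp: head_of_def intro: cloG.intros)
  ultimately show ?case by blast
next
  case (DTest \<psi>)
  then have "Or \<psi> \<phi> \<in> FL \<xi>" by (meson FL_closed(1) fl_step.intros)
  moreover have "head_of (Dia (DTest \<psi>) \<phi>) (Or \<psi> \<phi>)"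
    by (auto simp: head_of_def intro: cloG.intros)
  ultimately show ?case by blast
qed (force intro: head_of_refl)+

lemma ex_head_of: "\<phi> \<in> FL \<xi> \<Longrightarrow> \<exists>\<psi> \<in> FL \<xi>. head_of \<phi> \<psi>"
  by (cases \<phi>) (force intro: ex_head_of_Dia head_of_refl)+

lemma is_head_sharp_MPos: "is_head \<phi> \<Longrightarrow> sharp \<phi> = MPos p \<Longrightarrow> \<phi> = Pos p"
  by (cases \<phi> rule: is_head.cases; auto)

lemma is_head_sharp_MNeg: "is_head \<phi> \<Longrightarrow> sharp \<phi> = MNeg p \<Longrightarrow> \<phi> = Neg p"
  by (cases \<phi> rule: is_head.cases; auto)

lemma is_head_sharp_MOr: "is_head \<phi> \<Longrightarrow> sharp \<phi> = MOr A B \<Longrightarrow>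
    \<exists>\<phi>\<^sub>1 \<phi>\<^sub>2. \<phi> = Or \<phi>\<^sub>1 \<phi>\<^sub>2 \<and> sharp \<phi>\<^sub>1 = A \<and> sharp \<phi>\<^sub>2 = B"
  by (cases \<phi> rule: is_head.cases; auto)

lemma is_head_sharp_MAnd: "is_head \<phi> \<Longrightarrow> sharp \<phi> = MAnd A B \<Longrightarrow>
    \<exists>\<phi>\<^sub>1 \<phi>\<^sub>2. \<phi> = And \<phi>\<^sub>1 \<phi>\<^sub>2 \<and> sharp \<phi>\<^sub>1 = A \<and> sharp \<phi>\<^sub>2 = B"
  by (cases \<phi> rule: is_head.cases; auto)

lemma is_head_sharp_MDia: "is_head \<phi> \<Longrightarrow> sharp \<phi> = MDia g A \<Longrightarrow>
    \<exists>\<psi>. \<phi> = Dia (Atom g) \<psi> \<and> sharp \<psi> = A"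
  by (cases \<phi> rule: is_head.cases; auto)

lemma is_head_sharp_MDualDia: "is_head \<phi> \<Longrightarrow> sharp \<phi> = MDualDia g A \<Longrightarrow>
    \<exists>\<psi>. \<phi> = Dia (DualAtom g) \<psi> \<and> sharp \<psi> = A"
  by (cases \<phi> rule: is_head.cases; auto)

text \<open>The tag on the bound variable is the game logic formula itself, so a fixpoint head is
  determined by its translation. At a repetition, only the context and the undecomposed form of the
  principal formula can differ.\<close>

lemma is_head_sharp_Mu: "is_head \<phi> \<Longrightarrow> sharp \<phi> = Mu x A \<Longrightarrow>
    \<phi> = x \<and> (\<exists>\<gamma> \<psi>. \<phi> = Dia (AIter \<gamma>) \<psi>)"
  by (cases \<phi> rule: is_head.cases; auto)

lemma is_head_sharp_Nu: "is_head \<phi> \<Longrightarrow> sharp \<phi> = Nu x A \<Longrightarrow>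
    \<phi> = x \<and> (\<exists>\<gamma> \<psi>. \<phi> = Dia (DIter \<gamma>) \<psi>)"
  by (cases \<phi> rule: is_head.cases; auto)


section \<open>Lifting sequents and proofs\<close>

definition good :: "(('p, 'g) fm, ('p, 'g) fm) asequent \<Rightarrow> bool" where
  "good \<Phi> \<longleftrightarrow> (\<forall>z \<in> fset \<Phi>. is_gannot (snd z))"

definition rename :: "('i \<times> nat \<Rightarrow> ('i \<times> nat) list) \<Rightarrow> 'i annot \<Rightarrow> 'i annot" where
  "rename f a = concat (map f a)"

definition index_preserving :: "('i \<times> nat \<Rightarrow> ('i \<times> nat) list) \<Rightarrow> bool" where
  "index_preserving f \<longleftrightarrow> (\<forall>z. \<forall>y \<in> set (f z). fst y = fst z)"

text \<open>Supersets of a lift are lifts, so principal formulas never have to be removed.\<close>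

definition lifts :: "('p, 'g) fm \<Rightarrow> (('p, 'g) fm \<times> nat \<Rightarrow> (('p, 'g) fm \<times> nat) list)
    \<Rightarrow> (('p, 'g, ('p, 'g) fm) mfm, ('p, 'g) fm) asequent
    \<Rightarrow> (('p, 'g) fm, ('p, 'g) fm) asequent \<Rightarrow> bool" where
  "lifts \<xi> f \<Gamma> \<Phi> \<longleftrightarrow>
     (\<forall>(A, a) \<in> fset \<Gamma>. \<exists>\<phi> \<in> FL \<xi>. sharp \<phi> = A \<and> (\<phi>, rename f a) \<in> fset \<Phi>)"

lemma good_finsert [simp]: "good (finsert (\<phi>, a) \<Phi>) \<longleftrightarrow> is_gannot a \<and> good \<Phi>"
  by (simp add: good_def)

lemma goodD: "good \<Phi> \<Longrightarrow> (\<phi>, a) |\<in>| \<Phi> \<Longrightarrow> is_gannot a"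
  by (auto simp: good_def)

lemma good_subset: "good \<Phi> \<Longrightarrow> \<Psi> |\<subseteq>| \<Phi> \<Longrightarrow> good \<Psi>"
  by (auto simp: good_def)

lemma is_gannot_subseq:
  assumes "is_gannot b" "subseq a b"
  shows "is_gannot a"
proof -
  obtain N where a: "a = nths b N" using assms(2) subseq_conv_nths by blast
  have "sorted_wrt P (nths xs N)" if "sorted_wrt P xs" for P N and xs :: "(('a, 'b) fm \<times> nat) list"
    using that
    by (induction xs arbitrary: N) (auto simp: nths_Cons dest!: in_set_nthsD)
  then show ?thesis using assms(1) a notin_set_nthsI
    by (fastforce simp: is_gannot_def is_annot_def dest: in_set_nthsD)
qed

lemma rename_append: "rename f (a @ b) = rename f a @ rename f b"
  by (simp add: rename_def)

lemma rename_upd: "z \<notin> set a \<Longrightarrow> rename (f(z := l)) a = rename f a"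
  by (induction a) (auto simp: rename_def)

lemma rename_subseq: "subseq a b \<Longrightarrow> subseq (rename f a) (rename f b)"
  by (induction rule: list_emb.induct) (auto simp: rename_def list_emb_append_mono)

text \<open>Priorities depend only on the index of a name, and \<open>f\<close> replaces a name by
  names with the same index.\<close>

lemma annot_le_rename:
  assumes "annot_le (var_le (sharp \<xi>)) a x" "index_preserving f"
  shows "annot_le fp_le (rename f a) x"
  using assms var_le_sharp_imp_fp_le unfolding annot_le_def rename_def index_preserving_def
  by fastforce

lemma index_preserving_upd:
  "index_preserving f \<Longrightarrow> fst ` set l \<subseteq> {fst z} \<Longrightarrow> index_preserving (f(z := l))"
  by (auto simp: index_preserving_def)

lemma lifts_finsert:
  "lifts \<xi> f (finsert (A, a) \<Gamma>) \<Phi> \<longleftrightarrow>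
     (\<exists>\<phi> \<in> FL \<xi>. sharp \<phi> = A \<and> (\<phi>, rename f a) |\<in>| \<Phi>) \<and> lifts \<xi> f \<Gamma> \<Phi>"
  by (auto simp: lifts_def)

lemma lifts_mono: "lifts \<xi> f \<Gamma> \<Phi> \<Longrightarrow> \<Phi> |\<subseteq>| \<Psi> \<Longrightarrow> lifts \<xi> f \<Gamma> \<Psi>"
  by (fastforce simp: lifts_def)

lemma lifts_cong:
  assumes "\<And>z. z \<in> seq_names \<Gamma> \<Longrightarrow> f z = h z"
  shows "lifts \<xi> f \<Gamma> \<Phi> = lifts \<xi> h \<Gamma> \<Phi>"
proof -
  have *: "rename f a = rename h a" if "(A, a) \<in> fset \<Gamma>" for A a
  proof -
    have "set a \<subseteq> seq_names \<Gamma>" using that by (auto simp: seq_names_def)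
    then show ?thesis using assms unfolding rename_def
      by (intro arg_cong[where f = concat] map_cong) auto
  qed
  show ?thesis unfolding lifts_def by (intro ball_cong refl) (auto simp: *)
qed

lemma lifts_upd: "z \<notin> seq_names \<Gamma> \<Longrightarrow> lifts \<xi> (f(z := l)) \<Gamma> \<Phi> = lifts \<xi> f \<Gamma> \<Phi>"
  by (rule lifts_cong) auto

text \<open>Only pairs of a formula in the finite closure and a renamed annotation from
  \<open>\<Gamma>\<close> can witness a lift. One \<open>U\<close> serves all lifts, which bounds
  the number of passes through a loop.\<close>

lemma ex_finite_lift_universe:
  "\<exists>U. \<forall>\<Phi>. lifts \<xi> f \<Gamma> \<Phi> \<longrightarrow> lifts \<xi> f \<Gamma> (\<Phi> |\<inter>| U)"
proof -
  define N where "N = FL \<xi> \<times> (rename f \<circ> snd) ` fset \<Gamma>"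
  have "finite N" by (simp add: N_def finite_FL)
  then obtain U where "fset U = N" by (metis Abs_fset_inverse mem_Collect_eq)
  then have "lifts \<xi> f \<Gamma> (\<Phi> |\<inter>| U)" if "lifts \<xi> f \<Gamma> \<Phi>" for \<Phi>
    using that by (force simp: lifts_def N_def)
  then show ?thesis by blast
qed

section \<open>Weakening, fresh names and unrolling of loops in the game logic calculus\<close>

lemma cloG_weaken:
  assumes "cloG K \<Psi>" "\<Psi> |\<subseteq>| \<Phi>" "good \<Phi>"
  shows "cloG K \<Phi>"
proof -
  have "cloG K (\<Theta> |\<union>| \<Psi>)" if "good \<Theta>" for \<Theta>
    using that
  proof (induction \<Theta>)
    case empty
    then show ?case using assms(1) by simp
  next
    case (insert z \<Theta>)
    then show ?case by (cases z) (auto intro: cloG.weak)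
  qed
  then have "cloG K (\<Phi> |\<union>| \<Psi>)" using assms(3) by blast
  then show ?thesis using assms(2) by (simp add: sup.absorb1)
qed

lemma finite_seq_names: "finite (seq_names \<Phi>)"
  by (auto simp: seq_names_def)

lemma ex_fresh_name:
  assumes "finite K"
  shows "\<exists>n. (x, n) \<notin> seq_names \<Phi> \<and> (\<forall>\<Delta> \<in> K. (x, n) \<notin> seq_names \<Delta>)"
proof -
  let ?N = "seq_names \<Phi> \<union> (\<Union>\<Delta> \<in> K. seq_names \<Delta>)"
  have "finite (snd ` ?N)" using assms by (simp add: finite_seq_names)
  then obtain n where "n \<notin> snd ` ?N" using ex_new_if_finite[OF infinite_UNIV_nat] by blast
  then show ?thesis by force
qed

lemma is_gannot_snoc:
  assumes "is_gannot a" "annot_le fp_le a x" "(x, n) \<notin> set a" "is_gfp x"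
  shows "is_gannot (a @ [(x, n)])"
  using assms by (auto simp: is_gannot_def is_annot_def annot_le_def sorted_wrt_append)

text \<open>
  Here \<open>S\<close> collects the contexts of the earlier passes through the loop: all their companions
  are available in \<open>K\<close>, each annotated with the names that had been introduced at that time.
\<close>

lemma loop_unrolling:
  fixes \<gamma> \<chi> b
  defines "x \<equiv> Dia (DIter \<gamma>) \<chi>"
  assumes b: "annot_le fp_le b x"
    and univ: "\<And>s. Q s \<Longrightarrow> Q (s |\<inter>| U)"
    and unfold: "\<And>ns s K. \<lbrakk>fst ` set ns \<subseteq> {x}; finite K; K\<^sub>0 \<subseteq> K; Q s; good (finsert (x, b @ ns) s);
        \<And>K' s'. \<lbrakk>finite K'; K \<subseteq> K'; Q s'; good (finsert (x, b @ ns) s')\<rbrakk>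
          \<Longrightarrow> cloG K' (finsert (x, b @ ns) s')\<rbrakk>
      \<Longrightarrow> cloG K (finsert (And \<chi> (Dia \<gamma> x), b @ ns) s)"
  assumes "\<forall>s \<in> fset S. \<exists>ms. prefix ms ns \<and> finsert (x, b @ ms) s \<in> K"
    and "S |\<subseteq>| fPow U" "fst ` set ns \<subseteq> {x}" "finite K" "K\<^sub>0 \<subseteq> K" "Q s"
    and "good (finsert (x, b @ ns) s)"
  shows "cloG K (finsert (x, b @ ns) s)"
  using assms(5-)
\<comment> \<open>The measure counts the subsets of \<open>U\<close> not yet met as contexts; each
  new pass meets one more.\<close>
proof (induction "fcard (fPow U |-| S)" arbitrary: S ns K s rule: less_induct)
  case less
  \<comment> \<open>A leaf must equal its companion exactly, so the context is first cut down to one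
    of the finitely many subsets of \<open>U\<close>; weakening restores \<open>s\<close> at the
    end.\<close>
  let ?s = "s |\<inter>| U"
  have good: "is_gannot (b @ ns)" "good ?s"
    using less.prems(7) good_subset[of s ?s] by auto
  have "cloG K (finsert (x, b @ ns) ?s)"
  \<comment> \<open>If this context occurred before, its companion carries a prefix of the present
    names, and expansion supplies the missing ones.\<close>
  proof (cases "?s |\<in>| S")
    case True
    then obtain ms where ms: "prefix ms ns" "finsert (x, b @ ms) ?s \<in> K"
      using less.prems(1) by blast
    then have "subseq (b @ ms) (b @ ns)"
      by (simp add: list_emb_append_mono prefix_imp_subseq)
    then show ?thesis using cloG.leaf[OF ms(2)] good(1) by (blast intro: cloG.exp)
  next
    case False
    obtain n where n: "(x, n) \<notin> seq_names (finsert (x, b @ ns) ?s)"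
        "\<forall>\<Delta> \<in> K. (x, n) \<notin> seq_names \<Delta>"
      using ex_fresh_name[OF less.prems(4)] by blast
    let ?ns = "ns @ [(x, n)]"
    let ?\<Delta> = "finsert (x, b @ ?ns) ?s"
    let ?K = "insert ?\<Delta> K"
    have n': "(x, n) \<notin> set (b @ ns)" "(x, n) \<notin> seq_names ?s"
      using n(1) by (auto simp: seq_names_def)
    have le: "annot_le fp_le (b @ ns) x"
      using b less.prems(3) by (fastforce simp: annot_le_def fp_le_def)
    have gfp: "is_gfp x" by (simp add: is_gfp_def x_def)
    have ns: "fst ` set ?ns \<subseteq> {x}" using less.prems(3) by simp
    have U: "finsert ?s S |\<subseteq>| fPow U" using less.prems(2) by auto
    have card: "fcard (fPow U |-| finsert ?s S) < fcard (fPow U |-| S)"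
      using False by (intro pfsubset_fcard_mono) auto
    have S: "\<forall>s \<in> fset (finsert ?s S). \<exists>ms. prefix ms ?ns \<and> finsert (x, b @ ms) s \<in> ?K"
      using less.prems(1) by (auto intro: prefix_prefix)
    \<comment> \<open>This is the continuation that \<open>unfold\<close> expects. It must allow
      larger \<open>K'\<close>, since further companions may be added before the loop is reached
      again.\<close>
    have again: "cloG K' (finsert (x, b @ ?ns) s')"
      if "finite K'" "?K \<subseteq> K'" "Q s'" "good (finsert (x, b @ ?ns) s')" for K' s'
    proof (rule less.hyps[of "finsert ?s S"])
      show "\<forall>s \<in> fset (finsert ?s S). \<exists>ms. prefix ms ?ns \<and> finsert (x, b @ ms) s \<in> K'"
        using S that(2) by blast
      show "K\<^sub>0 \<subseteq> K'" using less.prems(5) that(2) by blast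
    qed (fact U card that ns)+
    have "good ?\<Delta>" using is_gannot_snoc[OF good(1) le n'(1) gfp] good(2) by simp
    then have "cloG ?K (finsert (And \<chi> (Dia \<gamma> x), b @ ?ns) ?s)"
      by (intro unfold[OF ns _ _ univ[OF less.prems(6)]])
        (use less.prems(4,5) again in \<open>auto simp: subset_insertI2\<close>)
    then show ?thesis
      using cloG.clo[of \<gamma> \<chi> "b @ ns" n ?s K] le n' n(2) by (simp add: x_def)
  qed
  then show ?case by (rule cloG_weaken[OF _ _ less.prems(7)]) auto
qed

section \<open>Lifting of whole proofs\<close>

lemma lifts_headE:
  assumes "lifts \<xi> f (finsert (A, a) \<Gamma>) \<Phi>"
  obtains \<phi> \<psi> where "\<phi> \<in> FL \<xi>" "sharp \<phi> = A" "(\<phi>, rename f a) |\<in>| \<Phi>" "lifts \<xi> f \<Gamma> \<Phi>"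
    "\<psi> \<in> FL \<xi>" "is_head \<psi>" "sharp \<psi> = A" "head_of \<phi> \<psi>"
proof -
  from assms obtain \<phi> where \<phi>: "\<phi> \<in> FL \<xi>" "sharp \<phi> = A" "(\<phi>, rename f a) |\<in>| \<Phi>" "lifts \<xi> f \<Gamma> \<Phi>"
    by (auto simp: lifts_finsert)
  with ex_head_of[of \<phi> \<xi>] obtain \<psi> where "\<psi> \<in> FL \<xi>" "head_of \<phi> \<psi>" by blast
  with \<phi> that show thesis by (auto simp: head_of_def)
qed

lemma cloG_head_of_mem:
  assumes "head_of \<phi> \<psi>" "(\<phi>, b) |\<in>| \<Phi>" "cloG K (finsert (\<psi>, b) \<Phi>)"
  shows "cloG K \<Phi>"
  using cloG_head_of[OF assms(1,3)] assms(2) by (simp add: finsert_absorb)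

lemma lifts_finsert_self:
  "\<phi> \<in> FL \<xi> \<Longrightarrow> lifts \<xi> f \<Gamma> \<Phi> \<Longrightarrow>
     lifts \<xi> f (finsert (sharp \<phi>, a) \<Gamma>) (finsert (\<phi>, rename f a) \<Phi>)"
  by (auto simp: lifts_finsert intro: lifts_mono)

text \<open>A leaf of the mu-calculus proof is replaced by the promise that each of its good lifts
  is derivable. The promise covers larger sets of companions because closure rules between the
  companion and the leaf add some; finiteness leaves room for fresh names.\<close>

definition discharged where
  "discharged \<xi> f K \<Delta> \<longleftrightarrow> (\<forall>K' \<Phi>. finite K' \<longrightarrow> K \<subseteq> K' \<longrightarrow> good \<Phi> \<longrightarrow> lifts \<xi> f \<Delta> \<Phi> \<longrightarrow> cloG K' \<Phi>)"

text \<open>Induction on the mu-calculus proof, for all lifts and renamings at once: a loop may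
  return with a different lift and with more names. In a logical rule the principal formula is
  replaced by a head, to which the matching rule of \<open>cloG\<close> applies.\<close>

lemma cloM_lift:
  assumes "cloM (sharp \<xi>) H \<Gamma>" "index_preserving f" "finite K" "good \<Phi>" "lifts \<xi> f \<Gamma> \<Phi>"
    and "\<forall>\<Delta> \<in> H. discharged \<xi> f K \<Delta>"
  shows "cloG K \<Phi>"
  using assms
proof (induction arbitrary: f K \<Phi>)
  case (leaf \<Gamma> H)
  then show ?case by (auto simp: discharged_def)
next
  case (ax H p)
  from ax.prems(4) obtain \<phi> \<phi>' where \<phi>: "(\<phi>, rename f []) |\<in>| \<Phi>"
      "is_head \<phi>'" "sharp \<phi>' = MPos p" "head_of \<phi> \<phi>'" and l: "lifts \<xi> f {|(MNeg p, [])|} \<Phi>"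
    by (rule lifts_headE)
  from l obtain \<psi> \<psi>' where \<psi>: "(\<psi>, rename f []) |\<in>| \<Phi>"
      "is_head \<psi>'" "sharp \<psi>' = MNeg p" "head_of \<psi> \<psi>'"
    by (rule lifts_headE)
  have "(\<phi>, []) |\<in>| \<Phi>" "(\<psi>, []) |\<in>| \<Phi>" "head_of \<phi> (Pos p)" "head_of \<psi> (Neg p)"
    using \<phi> \<psi> is_head_sharp_MPos[OF \<phi>(2,3)] is_head_sharp_MNeg[OF \<psi>(2,3)]
    by (auto simp: rename_def)
  moreover from this have "cloG K {|(Neg p, []), (\<phi>, [])|}"
    using cloG_head_of[OF _ cloG.ax[of K p]] by (simp add: finsert_commute)
  ultimately have "cloG K {|(\<psi>, []), (\<phi>, [])|}" using cloG_head_of by blast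
  then show ?case using \<phi>(1) \<psi>(1) ax.prems(3) by (auto simp: rename_def intro: cloG_weaken)
next
  case (disj H A a B \<Gamma>)
  from disj.prems(4) obtain \<phi> \<psi> where \<phi>: "(\<phi>, rename f a) |\<in>| \<Phi>" "lifts \<xi> f \<Gamma> \<Phi>" "\<psi> \<in> FL \<xi>"
      "head_of \<phi> \<psi>" "is_head \<psi>" "sharp \<psi> = MOr A B"
    by (rule lifts_headE)
  then obtain \<psi>\<^sub>1 \<psi>\<^sub>2 where \<psi>: "\<psi> = Or \<psi>\<^sub>1 \<psi>\<^sub>2" "sharp \<psi>\<^sub>1 = A" "sharp \<psi>\<^sub>2 = B"
    using is_head_sharp_MOr by blast
  then have "\<psi>\<^sub>1 \<in> FL \<xi>" "\<psi>\<^sub>2 \<in> FL \<xi>" using \<phi>(3) by (blast intro: FL_closed(1) fl_step.intros)+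
  then have "cloG K (finsert (\<psi>\<^sub>1, rename f a) (finsert (\<psi>\<^sub>2, rename f a) \<Phi>))"
    using lifts_finsert_self[OF _ lifts_finsert_self[OF _ \<phi>(2)]] \<psi>(2,3) disj.prems
      goodD[OF disj.prems(3) \<phi>(1)] by (intro disj.IH) auto
  then show ?case using cloG_head_of_mem[OF \<phi>(4,1)] \<psi>(1) by (simp add: cloG.disj)
next
  case (conj H A a \<Gamma> B)
  from conj.prems(4) obtain \<phi> \<psi> where \<phi>: "(\<phi>, rename f a) |\<in>| \<Phi>" "lifts \<xi> f \<Gamma> \<Phi>" "\<psi> \<in> FL \<xi>"
      "head_of \<phi> \<psi>" "is_head \<psi>" "sharp \<psi> = MAnd A B"
    by (rule lifts_headE)
  then obtain \<psi>\<^sub>1 \<psi>\<^sub>2 where \<psi>: "\<psi> = And \<psi>\<^sub>1 \<psi>\<^sub>2" "sharp \<psi>\<^sub>1 = A" "sharp \<psi>\<^sub>2 = B"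
    using is_head_sharp_MAnd by blast
  then have \<psi>': "\<psi>\<^sub>1 \<in> FL \<xi>" "\<psi>\<^sub>2 \<in> FL \<xi>"
    using \<phi>(3) by (blast intro: FL_closed(1) fl_step.intros)+
  have "cloG K (finsert (\<psi>\<^sub>1, rename f a) \<Phi>)"
    using lifts_finsert_self[OF \<psi>'(1) \<phi>(2)] \<psi>(2,3) conj.prems
      goodD[OF conj.prems(3) \<phi>(1)] by (intro conj.IH(1)) auto
  moreover have "cloG K (finsert (\<psi>\<^sub>2, rename f a) \<Phi>)"
    using lifts_finsert_self[OF \<psi>'(2) \<phi>(2)] \<psi>(2,3) conj.prems
      goodD[OF conj.prems(3) \<phi>(1)] by (intro conj.IH(2)) auto
  ultimately show ?case using cloG_head_of_mem[OF \<phi>(4,1)] \<psi>(1) by (simp add: cloG.conj)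
next
  case (modal H A a B b g)
  from modal.prems(4) obtain \<phi> \<phi>' where \<phi>: "(\<phi>, rename f a) |\<in>| \<Phi>" "\<phi>' \<in> FL \<xi>"
      "head_of \<phi> \<phi>'" "is_head \<phi>'" "sharp \<phi>' = MDia g A" and l: "lifts \<xi> f {|(MDualDia g B, b)|} \<Phi>"
    by (rule lifts_headE)
  from l obtain \<psi> \<psi>' where \<psi>: "(\<psi>, rename f b) |\<in>| \<Phi>" "\<psi>' \<in> FL \<xi>"
      "head_of \<psi> \<psi>'" "is_head \<psi>'" "sharp \<psi>' = MDualDia g B"
    by (rule lifts_headE)
  obtain \<phi>\<^sub>1 where \<phi>\<^sub>1: "\<phi>' = Dia (Atom g) \<phi>\<^sub>1" "sharp \<phi>\<^sub>1 = A"
    using is_head_sharp_MDia[OF \<phi>(4,5)] by blast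
  obtain \<psi>\<^sub>1 where \<psi>\<^sub>1: "\<psi>' = Dia (DualAtom g) \<psi>\<^sub>1" "sharp \<psi>\<^sub>1 = B"
    using is_head_sharp_MDualDia[OF \<psi>(4,5)] by blast
  have "\<phi>\<^sub>1 \<in> FL \<xi>" "\<psi>\<^sub>1 \<in> FL \<xi>"
    using \<phi>(2) \<psi>(2) \<phi>\<^sub>1(1) \<psi>\<^sub>1(1) by (blast intro: FL_closed(1) fl_step.intros)+
  \<comment> \<open>The modal rule admits no context, so the two-formula sequent is derived first
    and weakened to \<open>\<Phi>\<close> at the end.\<close>
  then have "cloG K {|(\<phi>\<^sub>1, rename f a), (\<psi>\<^sub>1, rename f b)|}"
    using \<phi>\<^sub>1 \<psi>\<^sub>1 modal.prems goodD[OF modal.prems(3) \<phi>(1)] goodD[OF modal.prems(3) \<psi>(1)]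
    by (intro modal.IH) (auto simp: lifts_def good_def)
  then have "cloG K {|(\<phi>', rename f a), (\<psi>', rename f b)|}"
    unfolding \<phi>\<^sub>1(1) \<psi>\<^sub>1(1) by (rule cloG.modal)
  then have "cloG K {|(\<psi>', rename f b), (\<phi>, rename f a)|}"
    using cloG_head_of[OF \<phi>(3)] by (simp add: finsert_commute)
  then have "cloG K {|(\<psi>, rename f b), (\<phi>, rename f a)|}"
    by (rule cloG_head_of[OF \<psi>(3)])
  then show ?case using \<phi>(1) \<psi>(1) modal.prems(3) by (auto intro: cloG_weaken)
next
  case (mu H x A a \<Gamma>)
  from mu.prems(4) obtain \<phi> \<psi> where \<phi>: "(\<phi>, rename f a) |\<in>| \<Phi>" "lifts \<xi> f \<Gamma> \<Phi>" "\<psi> \<in> FL \<xi>"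
      "head_of \<phi> \<psi>" "is_head \<psi>" "sharp \<psi> = Mu x A"
    by (rule lifts_headE)
  then obtain \<gamma> \<chi> where \<psi>: "\<psi> = x" "\<psi> = Dia (AIter \<gamma>) \<chi>" using is_head_sharp_Mu by blast
  let ?\<psi> = "Or \<chi> (Dia \<gamma> (Dia (AIter \<gamma>) \<chi>))"
  have "?\<psi> \<in> FL \<xi>" using \<phi>(3) \<psi>(2) by (blast intro: FL_closed(1) fl_step.intros)
  moreover have "sharp ?\<psi> = msubst x (Mu x A) A"
    by (rule msubst_sharp_AIter[OF \<phi>(6)[unfolded \<psi>(2)], symmetric])
  ultimately have "lifts \<xi> f (finsert (msubst x (Mu x A) A, a) \<Gamma>) (finsert (?\<psi>, rename f a) \<Phi>)"
    using lifts_finsert_self[of ?\<psi> \<xi> f \<Gamma> \<Phi> a] \<phi>(2) by (simp del: sharp.simps)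
  then have "cloG K (finsert (?\<psi>, rename f a) \<Phi>)"
    using mu.prems goodD[OF mu.prems(3) \<phi>(1)] by (intro mu.IH) auto
  then have "cloG K (finsert (\<psi>, rename f a) \<Phi>)"
    using annot_le_rename[OF mu.hyps(2) mu.prems(1)] unfolding \<psi>(1)[symmetric] \<psi>(2)
    by (rule cloG.aiter)
  then show ?case by (rule cloG_head_of_mem[OF \<phi>(4,1)])
next
  case (nu H x A a \<Gamma>)
  from nu.prems(4) obtain \<phi> \<psi> where \<phi>: "(\<phi>, rename f a) |\<in>| \<Phi>" "lifts \<xi> f \<Gamma> \<Phi>" "\<psi> \<in> FL \<xi>"
      "head_of \<phi> \<psi>" "is_head \<psi>" "sharp \<psi> = Nu x A"
    by (rule lifts_headE)
  then obtain \<gamma> \<chi> where \<psi>: "\<psi> = x" "\<psi> = Dia (DIter \<gamma>) \<chi>" using is_head_sharp_Nu by blast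
  let ?\<psi> = "And \<chi> (Dia \<gamma> (Dia (DIter \<gamma>) \<chi>))"
  have "?\<psi> \<in> FL \<xi>" using \<phi>(3) \<psi>(2) by (blast intro: FL_closed(1) fl_step.intros)
  moreover have "sharp ?\<psi> = msubst x (Nu x A) A"
    by (rule msubst_sharp_DIter[OF \<phi>(6)[unfolded \<psi>(2)], symmetric])
  ultimately have "lifts \<xi> f (finsert (msubst x (Nu x A) A, a) \<Gamma>) (finsert (?\<psi>, rename f a) \<Phi>)"
    using lifts_finsert_self[of ?\<psi> \<xi> f \<Gamma> \<Phi> a] \<phi>(2) by (simp del: sharp.simps)
  then have "cloG K (finsert (?\<psi>, rename f a) \<Phi>)"
    using nu.prems goodD[OF nu.prems(3) \<phi>(1)] by (intro nu.IH) auto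
  then have "cloG K (finsert (\<psi>, rename f a) \<Phi>)"
    using annot_le_rename[OF nu.hyps(2) nu.prems(1)] unfolding \<psi>(1)[symmetric] \<psi>(2)
    by (rule cloG.diter)
  then show ?case by (rule cloG_head_of_mem[OF \<phi>(4,1)])
next
  case (weak H \<Gamma> a A)
  then show ?case by (auto simp: lifts_finsert)
next
  case (exp H A a \<Gamma> b)
  from exp.prems(4) obtain \<phi> where \<phi>: "\<phi> \<in> FL \<xi>" "sharp \<phi> = A" "(\<phi>, rename f b) |\<in>| \<Phi>" "lifts \<xi> f \<Gamma> \<Phi>"
    by (auto simp: lifts_finsert)
  have b: "is_gannot (rename f b)" using goodD[OF exp.prems(3) \<phi>(3)] .
  have ab: "subseq (rename f a) (rename f b)" using exp.hyps(2) by (rule rename_subseq)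
  have "cloG K (finsert (\<phi>, rename f a) \<Phi>)"
    using exp.prems lifts_finsert_self[OF \<phi>(1,4), of a] \<phi>(2) is_gannot_subseq[OF b ab]
    by (intro exp.IH) auto
  then have "cloG K (finsert (\<phi>, rename f b) \<Phi>)" using ab b by (rule cloG.exp)
  then show ?case using \<phi>(3) by (simp add: finsert_absorb)
next
  case (clo x A a n \<Gamma> H)
  from clo.prems(4) obtain \<phi> \<psi> where \<phi>: "(\<phi>, rename f a) |\<in>| \<Phi>" "lifts \<xi> f \<Gamma> \<Phi>" "\<psi> \<in> FL \<xi>"
      "head_of \<phi> \<psi>" "is_head \<psi>" "sharp \<psi> = Nu x A"
    by (rule lifts_headE)
  then obtain \<gamma> \<chi> where \<psi>: "\<psi> = x" "\<psi> = Dia (DIter \<gamma>) \<chi>" using is_head_sharp_Nu by blast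
  then have x: "x = Dia (DIter \<gamma>) \<chi>" by simp
  let ?\<psi> = "And \<chi> (Dia \<gamma> x)"
  let ?\<Delta> = "finsert (Nu x A, a @ [(x, n)]) \<Gamma>"
  obtain U where U: "\<And>s. lifts \<xi> f \<Gamma> s \<Longrightarrow> lifts \<xi> f \<Gamma> (s |\<inter>| U)"
    using ex_finite_lift_universe by blast
  \<comment> \<open>This is the pass through the loop that \<open>loop_unrolling\<close> asks for,
    with \<open>ns\<close> the names accumulated so far and \<open>again\<close> the next
    pass.\<close>
  have unfold: "cloG K' (finsert (?\<psi>, rename f a @ ns) s)"
    if ns: "fst ` set ns \<subseteq> {x}" and K': "finite K'" "K \<subseteq> K'" and s: "lifts \<xi> f \<Gamma> s"
      "good (finsert (x, rename f a @ ns) s)"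
      and again: "\<And>K'' s'. \<lbrakk>finite K''; K' \<subseteq> K''; lifts \<xi> f \<Gamma> s'; good (finsert (x, rename f a @ ns) s')\<rbrakk>
          \<Longrightarrow> cloG K'' (finsert (x, rename f a @ ns) s')"
    for ns s K'
  proof -
    \<comment> \<open>The name of the closure rule now stands for the whole list \<open>ns\<close>.
      Its freshness for \<open>a\<close>, \<open>\<Gamma>\<close> and \<open>H\<close> means that
      nothing else is renamed differently.\<close>
    let ?f = "f((x, n) := ns)"
    have f: "index_preserving ?f" using clo.prems(1) ns by (simp add: index_preserving_upd)
    have ra: "rename ?f (a @ [(x, n)]) = rename f a @ ns"
      using clo.hyps(3) by (simp add: rename_append rename_upd) (simp add: rename_def)
    have \<Gamma>: "lifts \<xi> ?f \<Gamma> s' = lifts \<xi> f \<Gamma> s'" for s' using clo.hyps(4) by (rule lifts_upd)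
    have "?\<psi> \<in> FL \<xi>" using \<phi>(3) \<psi>(2) unfolding x by (blast intro: FL_closed(1) fl_step.intros)
    moreover have "sharp ?\<psi> = msubst x (Nu x A) A"
      unfolding x using msubst_sharp_DIter[OF \<phi>(6)[unfolded \<psi>(2)]] x by simp
    ultimately have l: "lifts \<xi> ?f (finsert (msubst x (Nu x A) A, a @ [(x, n)]) \<Gamma>)
        (finsert (?\<psi>, rename f a @ ns) s)"
      using lifts_finsert_self[of ?\<psi> \<xi> ?f \<Gamma> s "a @ [(x, n)]"] s(1) \<Gamma> ra
      by (simp del: sharp.simps)
    have "discharged \<xi> ?f K' \<Delta>" if "\<Delta> \<in> H" for \<Delta>
    proof -
      have "(x, n) \<notin> seq_names \<Delta>" "discharged \<xi> f K \<Delta>" using that clo.hyps(5) clo.prems(5) by auto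
      then show ?thesis using K'(2) unfolding discharged_def by (simp add: lifts_upd)
    qed
    \<comment> \<open>Any lift of the companion contains a formula whose head is \<open>x\<close>,
      annotated with the accumulated names, so the next pass derives it whatever its
      context.\<close>
    moreover have "discharged \<xi> ?f K' ?\<Delta>"
      unfolding discharged_def
    proof (intro allI impI)
      fix K'' \<Theta>
      assume K'': "finite K''" "K' \<subseteq> K''" and \<Theta>: "good \<Theta>" "lifts \<xi> ?f ?\<Delta> \<Theta>"
      from \<Theta>(2) obtain \<phi>' \<psi>' where \<phi>': "(\<phi>', rename ?f (a @ [(x, n)])) |\<in>| \<Theta>" "lifts \<xi> ?f \<Gamma> \<Theta>"
          "head_of \<phi>' \<psi>'" "is_head \<psi>'" "sharp \<psi>' = Nu x A"
        by (rule lifts_headE)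
      have "\<psi>' = x" using is_head_sharp_Nu[OF \<phi>'(4,5)] by blast
      moreover have "cloG K'' (finsert (x, rename f a @ ns) \<Theta>)"
        using \<Gamma> \<phi>'(2) \<Theta>(1) s(2) by (intro again K'') simp_all
      ultimately show "cloG K'' \<Theta>" using cloG_head_of_mem[OF \<phi>'(3,1)] ra by simp
    qed
    ultimately show ?thesis
      using s(2) by (intro clo.IH[OF f K'(1) _ l]) (simp_all del: fun_upd_apply)
  qed
  have le: "annot_le fp_le (rename f a) x" using annot_le_rename[OF clo.hyps(2) clo.prems(1)] .
  \<comment> \<open>The loop is entered with no names accumulated and no contexts met.\<close>
  have "cloG K (finsert (x, rename f a @ []) \<Phi>)"
    unfolding x
    by (rule loop_unrolling[where S = "{||}" and Q = "lifts \<xi> f \<Gamma>" and U = U and K\<^sub>0 = K,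
          OF le[unfolded x] U unfold[unfolded x]])
      (use \<phi>(2) clo.prems(2,3) goodD[OF clo.prems(3) \<phi>(1)] in simp_all)
  then show ?case using cloG_head_of_mem[OF \<phi>(4,1)] \<psi>(1) by simp
qed

theorem theorem7:
  fixes \<xi> :: "('p, 'g) fm"
  assumes "provable_CloM (sharp \<xi>)"
  shows "provable_CloG \<xi>"
proof -
  have "cloM (sharp \<xi>) {} {|(sharp \<xi>, [])|}" using assms by (simp add: provable_CloM_def)
  then have "cloG {} {|(\<xi>, [])|}"
    \<comment> \<open>The end sequent has the empty annotation and no open leaves, so every
      index-preserving renaming would do here.\<close>
    by (rule cloM_lift[where f = "\<lambda>_. []"])
      (auto simp: index_preserving_def good_def is_gannot_def is_annot_def lifts_def rename_def FL_refl)
  then show ?thesis by (simp add: provable_CloG_def)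
qed

end
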